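(* Consider the two $1$-cocycles associated to the cover $\{U_k^\pm\}_{k\in\mathbb Z}$ of $\mathbb C^\times\times M_+$ given by $\{\widetilde g^\pm_{k_1,k_2},\widetilde g^{\pm\infty}_{k_1,k_2}\}$ and $\{h^\pm_{k_1,k_2}|_{\mathbb C^\times\times M_+},h^{\pm\infty}_{k_1,k_2}|_{\mathbb C^\times\times M_+}\}$ (defined in the context). These $1$-cocycles are related by the conformal limit: after rescaling the central charge $Z\to RZ$ with $R>0$, and letting $R\to0$ while keeping $\lambda_{\mathrm B}=\zeta/R$ fixed, each function $h^\pm_{k_1,k_2}|_{\mathbb C^\times\times M_+}$, $h^{\pm\infty}_{k_1,k_2}|_{\mathbb C^\times\times M_+}$ tends to the corresponding $\widetilde g^\pm_{k_1,k_2}$, $\widetilde g^{\pm\infty}_{k_1,k_2}$.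
   Context: $M_+=\{(v,w)\in\mathbb C^2:w\ne0,\ v+nw\neq0\ \forall n\in\mathbb Z,\ \mathrm{Im}(v/w)>0\}$; $Z_{n\beta+m\delta}=2\pi \mathrm i(nv+mw)$; $\mathcal L_k=\mathbb R_{<0}\cdot Z_{\beta+k\delta}$, $\mathcal L_\infty=\mathbb R_{<0}\cdot Z_\delta$; $\rho_k$ is the middle ray of the sector between $\mathcal L_k$ and $\mathcal L_{k-1}$; $\mathbb H_\rho$ is the open half-plane centered at $\rho$; $U_k^\pm=\{(\zeta,v,w)\in\mathbb C^\times\times M_+:\zeta\in\mathbb H_{\pm\rho_k}\}$ (first coordinate called $\lambda_{\mathrm B}$ for $\widetilde g$ and $\zeta$ for $h$; the half-plane conditions are invariant under positive rescaling). $[\rho_{k_1},-\rho_{k_2}]$ is the smaller sector bounded by these rays. $\Omega(\pm\beta+n\delta)=1$, $\Omega(k\delta)=-2$ ($k\neq0$). $L(x)=\mathrm{Li}_2(x)+\frac12\log(x)\log(1-x)$ is the Rogers dilogarithm. For $\gamma=n\beta+m\delta$ let $\mathcal X_\gamma=\exp(Z_\gamma/\lambda_{\mathrm B})$ and, on the locus $\mathbb C^\times\times M_+$ where all angular coordinates $\theta$ vanish, $\mathcal Y_\gamma=\exp(\zeta^{-1}Z_\gamma+\zeta\overline{Z_\gamma})$; in $L(\mathcal X_\gamma)$, $L(\mathcal Y_\gamma)$ the logarithm $\log x$ is taken to be the displayed exponent, while $\mathrm{Li}_2$ and $\log(1-x)$ are principal ($|x|<1$ on the relevant overlaps). For $\mathcal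 V=\mathcal X$ (giving $\widetilde g$) and for $\mathcal V=\mathcal Y$ (giving $h|_{\mathbb C^\times\times M_+}$), the cocycle is: - if $U_{k_1}^\pm\cap U_{k_2}^\pm\neq\emptyset$, $k_1<k_2$: $\prod_{k_1\le k<k_2}\exp\big(\frac{\Omega(\beta+k\delta)}{2\pi \mathrm i}L(\mathcal V_{\pm(\beta+k\delta)})\big)$ [this is $\widetilde g^\pm_{k_1,k_2}$, resp. $h^\pm_{k_1,k_2}$]; - if $U_{k_1}^+\cap U_{k_2}^-\ne\emptyset$ and $\mathcal L_\infty\subset[\rho_{k_1},-\rho_{k_2}]$: $\prod_{k\ge k_1}\exp\big(\frac{\Omega(\beta+k\delta)}{2\pi \mathrm i}L(\mathcal V_{\beta+k\delta})\big)\prod_{k<k_2}\exp\big(\frac{\Omega(\beta+k\delta)}{2\pi \mathrm i}L(\mathcal V_{-(\beta+k\delta)})\big)\prod_{k\ge1}\exp\big(\frac{\Omega(k\delta)}{2\pi \mathrm i}L(\mathcal V_{k\delta})\big)$ [$\widetilde g^\infty_{k_1,k_2}$, resp. $h^\infty_{k_1,k_2}$]; - if $U_{k_1}^+\cap U_{k_2}^-\ne\emptyset$ and $-\mathcal L_\infty\subset[\rho_{k_1},-\rho_{k_2}]$: $\prod_{k\ge k_2}\exp\big(\frac{\Omega(\beta+k\delta)}{2\pi \mathrm i}L(\mathcal V_{-(\beta+k\delta)})\big)\prod_{k<k_1}\exp\big(\frac{\Omega(\beta+k\delta)}{2\pi \mathrm i}L(\mathcal V_{\beta+k\delta})\big)\prod_{k\ge1}\exp\big(\frac{\Omega(k\delta)}{2\pi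 \mathrm i}L(\mathcal V_{-k\delta})\big)$ [$\widetilde g^{-\infty}_{k_2,k_1}$, resp. $h^{-\infty}_{k_2,k_1}$]; - reversed index order gives inverses. The cocycle $\widetilde g$ describes the line bundle of which the normalized topological string partition function of the resolved conifold is a section, and $h$ is the restriction of the cocycle of the (twistor-space) hyperholomorphic line bundle associated to the BPS data. "Tends to" means pointwise convergence at each point of the respective overlap. *)

theory Defs
  imports "HOL-Analysis.Analysis"
begin

text \<open>A pair \<open>(n, m)\<close> stands for the charge \<open>n\<beta> + m\<delta>\<close>.\<close>

type_synonym charge = "int \<times> int"

definition Omega :: "charge \<Rightarrow> int" where
  "Omega \<gamma> = (if fst \<gamma> = 1 \<or> fst \<gamma> = -1 then 1
             else if fst \<gamma> = 0 \<and> snd \<gamma> \<noteq> 0 then -2 else 0)"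

definition Z :: "complex \<Rightarrow> complex \<Rightarrow> charge \<Rightarrow> complex" where
  "Z v w \<gamma> = 2 * of_real pi * \<i> * (of_int (fst \<gamma>) * v + of_int (snd \<gamma>) * w)"

definition M_plus :: "(complex \<times> complex) set" where
  "M_plus = {(v, w). w \<noteq> 0 \<and> (\<forall>n::int. v + of_int n * w \<noteq> 0) \<and> Im (v / w) > 0}"

subsection \<open>Rays, sectors and the cover\<close>

definition L_inf :: "complex \<Rightarrow> complex \<Rightarrow> complex set" where
  "L_inf v w = {of_real t * Z v w (0, 1) | t::real. t < 0}"

text \<open>
  The ray through the returned direction vector is obtained by turning the ray through \<open>b\<close> half
  of the way towards the ray through \<open>a\<close>. Since \<open>Arg\<close> has values in \<open>(-\<pi>, \<pi>]\<close>, this is the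
  middle of the smaller of the two sectors bounded by these rays.
\<close>

definition middle :: "complex \<Rightarrow> complex \<Rightarrow> complex" where
  "middle a b = b * cis (Arg (a / b) / 2)"

text \<open>
  A direction vector of the ray \<open>\<rho>\<^sub>k\<close>. The rays \<open>\<L>\<^sub>k\<close> and \<open>\<L>\<^sub>k\<^sub>-\<^sub>1\<close> consist of the negative multiples of
  \<open>Z v w (1, k)\<close> and \<open>Z v w (1, k - 1)\<close>, hence the signs.
\<close>

definition rho :: "complex \<Rightarrow> complex \<Rightarrow> int \<Rightarrow> complex" where
  "rho v w k = middle (- Z v w (1, k)) (- Z v w (1, k - 1))"

definition half_plane :: "complex \<Rightarrow> complex set" where
  "half_plane a = {z. z \<bullet> a > 0}"

text \<open>
  The smaller sector bounded by the rays through \<open>a\<close> and \<open>b\<close>, for \<open>a\<close> and \<open>b\<close> linearly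
  independent over the reals.
\<close>

definition sector :: "complex \<Rightarrow> complex \<Rightarrow> complex set" where
  "sector a b = {of_real s * a + of_real t * b | s t :: real. s \<ge> 0 \<and> t \<ge> 0 \<and> (s, t) \<noteq> (0, 0)}"

datatype sign = Plus | Minus

fun sg :: "sign \<Rightarrow> int" where
  "sg Plus = 1"
| "sg Minus = -1"

fun U :: "sign \<times> int \<Rightarrow> (complex \<times> complex \<times> complex) set" where
  "U (s, k) = {(\<zeta>, v, w). \<zeta> \<noteq> 0 \<and> (v, w) \<in> M_plus \<and> \<zeta> \<in> half_plane (of_int (sg s) * rho v w k)}"

subsection \<open>The cocycles\<close>

text \<open>
  The principal branch on the closed unit disc. In the cocycles below all arguments on the
  relevant overlaps have norm less than \<open>1\<close>.
\<close>

definition Li2 :: "complex \<Rightarrow> complex" where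
  "Li2 x = (\<Sum>n. x ^ Suc n / of_nat (Suc n) ^ 2)"

text \<open>
  \<open>Rogers e\<close> is the Rogers dilogarithm \<open>L(x)\<close> at \<open>x = exp e\<close>, where \<open>e\<close> is the chosen value of
  \<open>log x\<close>.
\<close>

definition Rogers :: "complex \<Rightarrow> complex" where
  "Rogers e = Li2 (exp e) + 1 / 2 * e * Ln (1 - exp e)"

text \<open>
  From here on, \<open>E\<close> assigns to a charge \<open>\<gamma>\<close> the exponent of \<open>\<V>\<^sub>\<gamma> = exp (E \<gamma>)\<close>. In
  the formulas for the cocycles a factor \<open>L(\<V>\<^sub>-\<^sub>\<gamma>)\<close> comes with the coefficient
  \<open>\<Omega>(\<gamma>)\<close>, which is \<open>Omega (- \<gamma>)\<close>.
\<close>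

definition factor :: "(charge \<Rightarrow> complex) \<Rightarrow> charge \<Rightarrow> complex" where
  "factor E \<gamma> = exp (of_int (Omega \<gamma>) / (2 * of_real pi * \<i>) * Rogers (E \<gamma>))"

lemma Omega_uminus: "Omega (- \<gamma>) = Omega \<gamma>"
  by (auto simp: Omega_def)

definition prod_from :: "int \<Rightarrow> (int \<Rightarrow> complex) \<Rightarrow> complex" where
  "prod_from k0 f = (\<Prod>n. f (k0 + int n))"

definition prod_below :: "int \<Rightarrow> (int \<Rightarrow> complex) \<Rightarrow> complex" where
  "prod_below k0 f = (\<Prod>n. f (k0 - 1 - int n))"

text \<open>\<open>trans_same E s k1 k2\<close>, for \<open>k1 < k2\<close>, is the transition function for \<open>(U\<^sub>k\<^sub>1\<^sup>s, U\<^sub>k\<^sub>2\<^sup>s)\<close>.\<close>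

definition trans_same :: "(charge \<Rightarrow> complex) \<Rightarrow> sign \<Rightarrow> int \<Rightarrow> int \<Rightarrow> complex" where
  "trans_same E s k1 k2 = (\<Prod>k\<in>{k1..<k2}. factor E (sg s, sg s * k))"

text \<open>\<open>trans_inf E k1 k2\<close> is the transition function with superscript \<open>\<infinity>\<close> for \<open>(U\<^sub>k\<^sub>1\<^sup>+, U\<^sub>k\<^sub>2\<^sup>-)\<close>.\<close>

definition trans_inf :: "(charge \<Rightarrow> complex) \<Rightarrow> int \<Rightarrow> int \<Rightarrow> complex" where
  "trans_inf E k1 k2 =
     prod_from k1 (\<lambda>k. factor E (1, k)) *
     prod_below k2 (\<lambda>k. factor E (- (1, k))) *
     prod_from 1 (\<lambda>k. factor E (0, k))"

text \<open>
  \<open>trans_minf E k2 k1\<close> is the transition function with superscript \<open>-\<infinity>\<close>. Mind the order of the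
  indices: it belongs to \<open>(U\<^sub>k\<^sub>2\<^sup>-, U\<^sub>k\<^sub>1\<^sup>+)\<close>.
\<close>

definition trans_minf :: "(charge \<Rightarrow> complex) \<Rightarrow> int \<Rightarrow> int \<Rightarrow> complex" where
  "trans_minf E k2 k1 =
     prod_from k2 (\<lambda>k. factor E (- (1, k))) *
     prod_below k1 (\<lambda>k. factor E (1, k)) *
     prod_from 1 (\<lambda>k. factor E (- (0, k)))"

text \<open>
  The last case of \<open>trans_opp\<close> does not occur on \<open>U (Plus, k1) \<inter> U (Minus, k2)\<close>, see
  \<open>opposite_cases\<close> below.
\<close>

definition trans_opp :: "complex \<Rightarrow> complex \<Rightarrow> (charge \<Rightarrow> complex) \<Rightarrow> int \<Rightarrow> int \<Rightarrow> complex" where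
  "trans_opp v w E k1 k2 =
     (if L_inf v w \<subseteq> sector (rho v w k1) (- rho v w k2) then trans_inf E k1 k2
      else if uminus ` L_inf v w \<subseteq> sector (rho v w k1) (- rho v w k2)
        then inverse (trans_minf E k2 k1)
      else undefined)"

fun transition ::
  "complex \<Rightarrow> complex \<Rightarrow> (charge \<Rightarrow> complex) \<Rightarrow> sign \<times> int \<Rightarrow> sign \<times> int \<Rightarrow> complex" where
  "transition v w E (Plus, k1) (Minus, k2) = trans_opp v w E k1 k2"
| "transition v w E (Minus, k2) (Plus, k1) = inverse (trans_opp v w E k1 k2)"
| "transition v w E (s, k1) (_, k2) =
     (if k1 < k2 then trans_same E s k1 k2
      else if k2 < k1 then inverse (trans_same E s k2 k1)
      else 1)"

definition X_exponent :: "complex \<Rightarrow> complex \<Rightarrow> complex \<Rightarrow> charge \<Rightarrow> complex" where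
  "X_exponent lamB v w \<gamma> = Z v w \<gamma> / lamB"

definition Y_exponent :: "complex \<Rightarrow> complex \<Rightarrow> complex \<Rightarrow> charge \<Rightarrow> complex" where
  "Y_exponent \<zeta> v w \<gamma> = inverse \<zeta> * Z v w \<gamma> + \<zeta> * cnj (Z v w \<gamma>)"

fun g_tilde :: "sign \<times> int \<Rightarrow> sign \<times> int \<Rightarrow> complex \<times> complex \<times> complex \<Rightarrow> complex" where
  "g_tilde i j (lamB, v, w) = transition v w (X_exponent lamB v w) i j"

fun h :: "sign \<times> int \<Rightarrow> sign \<times> int \<Rightarrow> complex \<times> complex \<times> complex \<Rightarrow> complex" where
  "h i j (\<zeta>, v, w) = transition v w (Y_exponent \<zeta> v w) i j"

subsection \<open>The overlaps\<close>

lemma Z_scale: "Z (of_real R * v) (of_real R * w) \<gamma> = of_real R * Z v w \<gamma>"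
  by (simp add: Z_def algebra_simps)

lemma rho_scale:
  assumes "R \<noteq> 0"
  shows "rho (of_real R * v) (of_real R * w) k = of_real R * rho v w k"
proof -
  have "(- (of_real R * Z v w (1, k))) / (- (of_real R * Z v w (1, k - 1))) =
        (- Z v w (1, k)) / (- Z v w (1, k - 1))"
    using assms by simp
  thus ?thesis
    unfolding rho_def middle_def Z_scale by simp
qed

lemma U_scale:
  assumes "R > 0" "(\<zeta>, v, w) \<in> U i"
  shows "(of_real R * \<zeta>, of_real R * v, of_real R * w) \<in> U i"
proof -
  obtain s k where i: "i = (s, k)" by (cases i)
  have M: "(of_real R * v, of_real R * w) \<in> M_plus"
  proof -
    have "of_real R * v + of_int n * (of_real R * w) = of_real R * (v + of_int n * w)" for n
      by (simp add: algebra_simps)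
    thus ?thesis using assms unfolding i M_plus_def by (auto simp: i M_plus_def)
  qed
  have "(of_real R * \<zeta>) \<bullet> (of_int (sg s) * (of_real R * rho v w k)) =
        R * R * (\<zeta> \<bullet> (of_int (sg s) * rho v w k))"
    by (simp add: inner_complex_def algebra_simps)
  moreover have "\<zeta> \<bullet> (of_int (sg s) * rho v w k) > 0"
    using assms(2) by (auto simp: i half_plane_def)
  ultimately have "(of_real R * \<zeta>) \<bullet> (of_int (sg s) * (of_real R * rho v w k)) > 0"
    using assms(1) by simp
  thus ?thesis
    using assms M by (auto simp: i half_plane_def rho_scale)
qed

lemma cis_half:
  assumes "-pi < a" "a < pi"
  shows "\<exists>c>0. cis (a / 2) = of_real c * (1 + cis a)"
proof (intro exI conjI)
  have pos: "cos (a / 2) > 0"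
    using assms by (intro cos_gt_zero_pi) auto
  show "1 / (2 * cos (a / 2)) > 0" using pos by simp
  have "1 + cis a = of_real (2 * cos (a / 2)) * cis (a / 2)"
    using cos_double_cos[of "a / 2"] sin_double[of "a / 2"]
    by (auto simp: complex_eq_iff power2_eq_square)
  thus "cis (a / 2) = of_real (1 / (2 * cos (a / 2))) * (1 + cis a)"
    using pos by (simp add: field_simps)
qed

lemma rho_form:
  assumes "(v, w) \<in> M_plus"
  shows "\<exists>c x. c > 0 \<and> of_int k - 1 < x \<and> x < of_int k \<and>
           rho v w k = of_real c * (- Z v w (0, 1)) * (v / w + of_real x)"
proof -
  define \<tau> where "\<tau> = v / w"
  have w: "w \<noteq> 0" and im: "Im \<tau> > 0" using assms by (auto simp: M_plus_def \<tau>_def)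
  define A where "A = \<tau> + of_int k"
  define B where "B = \<tau> + of_int (k - 1)"
  define d where "d = - Z v w (0, 1)"
  have ImA: "Im A > 0" and ImB: "Im B > 0" using im by (auto simp: A_def B_def)
  hence A0: "A \<noteq> 0" and B0: "B \<noteq> 0" by auto
  have d0: "d \<noteq> 0" using w by (simp add: d_def Z_def)
  have ZA: "- Z v w (1, k) = d * A" and ZB: "- Z v w (1, k - 1) = d * B"
    using w by (simp_all add: Z_def d_def A_def B_def \<tau>_def field_simps)
  have "Im (A / B) \<noteq> 0"
  proof -
    have "Im (A * cnj B) = - Im \<tau>" by (simp add: A_def B_def algebra_simps)
    moreover have "A / B = A * cnj B / of_real ((cmod B)\<^sup>2)"
      using complex_div_cnj[of A B] by simp
    hence "Im (A / B) = Im (A * cnj B) / (cmod B)\<^sup>2"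
      by (metis Im_divide_of_real)
    ultimately show ?thesis using im B0 by simp
  qed
  hence "A / B \<notin> \<real>" using complex_is_Real_iff by blast
  hence "Arg (A / B) \<noteq> pi"
    using Arg_eq_pi complex_is_Real_iff by blast
  hence "-pi < Arg (A / B)" "Arg (A / B) < pi"
    using Arg_bounded[of "A / B"] by auto
  then obtain c0 where c0: "c0 > 0"
      "cis (Arg (A / B) / 2) = of_real c0 * (1 + cis (Arg (A / B)))"
    using cis_half by blast
  have cisArg: "cis (Arg (A / B)) = A / B / of_real (cmod A / cmod B)"
    using A0 B0 cis_Arg[of "A / B"] by (simp add: sgn_eq norm_divide)
  define q where "q = cmod B / cmod A"
  have q: "q > 0" using A0 B0 by (simp add: q_def)
  have "rho v w k = d * B * (of_real c0 * (1 + A / B * of_real q))"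
    unfolding rho_def middle_def ZA ZB using d0 c0(2) cisArg
    by (simp add: q_def)
  also have "\<dots> = of_real c0 * d * (B + of_real q * A)"
    using B0 by (simp add: field_simps)
  also have "B + of_real q * A = of_real (1 + q) * (\<tau> + of_real (k - 1 / (1 + q)))"
  proof -
    have "of_real (1 + q) * (\<tau> + of_real (k - 1 / (1 + q))) =
          of_real (1 + q) * \<tau> + of_real ((1 + q) * (k - 1 / (1 + q)))"
      by (simp only: of_real_mult distrib_left)
    also have "(1 + q) * (k - 1 / (1 + q)) = (1 + q) * k - 1"
      using q by (simp add: field_simps)
    finally show ?thesis by (simp add: A_def B_def algebra_simps)
  qed
  finally have "rho v w k =
      of_real (c0 * (1 + q)) * d * (\<tau> + of_real (k - 1 / (1 + q)))"
    by (simp add: mult_ac)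
  moreover have "c0 * (1 + q) > 0" using c0 q by simp
  moreover have "of_int k - 1 < k - 1 / (1 + q)" "k - 1 / (1 + q) < of_int k"
    using q by (auto simp: field_simps)
  ultimately show ?thesis unfolding d_def \<tau>_def by blast
qed

lemma one_in_cone:
  assumes "Im \<tau> > 0" "c > 0" "c' > 0" "y < (x::real)"
  shows "\<exists>s t. s > 0 \<and> t > 0 \<and>
    1 = of_real s * (of_real c * (\<tau> + of_real x)) - of_real t * (of_real c' * (\<tau> + of_real y))"
proof (intro exI conjI)
  show "1 / (c * (x - y)) > 0" "1 / (c' * (x - y)) > 0" using assms by auto
  define u where "u = 1 / (x - y)"
  have "of_real (1 / (c * (x - y))) * (of_real c * (\<tau> + of_real x)) -
      of_real (1 / (c' * (x - y))) * (of_real c' * (\<tau> + of_real y)) =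
      of_real u * (\<tau> + of_real x) - of_real u * (\<tau> + of_real y)"
    using assms by (simp add: u_def)
  also have "\<dots> = of_real (u * (x - y))"
    by (simp add: algebra_simps)
  also have "\<dots> = 1" using assms by (simp add: u_def)
  finally show "1 = of_real (1 / (c * (x - y))) * (of_real c * (\<tau> + of_real x)) -
      of_real (1 / (c' * (x - y))) * (of_real c' * (\<tau> + of_real y))" by simp
qed

lemma opposite_cases:
  assumes "(\<zeta>, v, w) \<in> U (Plus, k1) \<inter> U (Minus, k2)"
  shows "k2 < k1 \<and> L_inf v w \<subseteq> sector (rho v w k1) (- rho v w k2) \<or>
         k1 < k2 \<and> uminus ` L_inf v w \<subseteq> sector (rho v w k1) (- rho v w k2)"
proof -
  have M: "(v, w) \<in> M_plus" using assms by auto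
  hence im: "Im (v / w) > 0" by (auto simp: M_plus_def)
  define d where "d = - Z v w (0, 1)"
  obtain c x where cx: "c > 0" "of_int k1 - 1 < x" "x < of_int k1"
      "rho v w k1 = of_real c * d * (v / w + of_real x)"
    using rho_form[OF M, of k1] unfolding d_def by blast
  obtain c' y where cy: "c' > 0" "of_int k2 - 1 < y" "y < of_int k2"
      "rho v w k2 = of_real c' * d * (v / w + of_real y)"
    using rho_form[OF M, of k2] unfolding d_def by blast
  have "k1 \<noteq> k2" using assms by (auto simp: half_plane_def)
  then consider "k2 < k1" | "k1 < k2" by linarith
  thus ?thesis
  proof cases
    case 1
    hence "of_int k2 \<le> (of_int k1 - 1 :: real)" by linarith
    hence "y < x" using cx cy by linarith
    then obtain s t where st: "s > 0" "t > 0" "1 = of_real s * (of_real c * (v / w + of_real x)) -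
        of_real t * (of_real c' * (v / w + of_real y))"
      using one_in_cone[OF im cx(1) cy(1)] by blast
    have d: "d = of_real s * rho v w k1 - of_real t * rho v w k2"
      using arg_cong[OF st(3), of "\<lambda>z. d * z"] unfolding cx(4) cy(4)
      by (simp add: algebra_simps)
    have "L_inf v w \<subseteq> sector (rho v w k1) (- rho v w k2)"
    proof
      fix z assume "z \<in> L_inf v w"
      then obtain r where r: "r < 0" "z = of_real r * Z v w (0, 1)" by (auto simp: L_inf_def)
      have "z = of_real (- r) * d" using r by (simp add: d_def)
      hence "z = of_real (- r * s) * rho v w k1 + of_real (- r * t) * (- rho v w k2)"
        unfolding d by (simp add: algebra_simps)
      moreover have "- r * s > 0" "- r * t > 0" using r st by (auto simp: mult_neg_pos)
      ultimately show "z \<in> sector (rho v w k1) (- rho v w k2)"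
        unfolding sector_def by (intro CollectI exI[of _ "- r * s"] exI[of _ "- r * t"]) auto
    qed
    thus ?thesis using 1 by blast
  next
    case 2
    hence "of_int k1 \<le> (of_int k2 - 1 :: real)" by linarith
    hence "x < y" using cx cy by linarith
    then obtain t s where st: "t > 0" "s > 0" "1 = of_real t * (of_real c' * (v / w + of_real y)) -
        of_real s * (of_real c * (v / w + of_real x))"
      using one_in_cone[OF im cy(1) cx(1)] by blast
    have d: "d = of_real t * rho v w k2 - of_real s * rho v w k1"
      using arg_cong[OF st(3), of "\<lambda>z. d * z"] unfolding cx(4) cy(4)
      by (simp add: algebra_simps)
    have "uminus ` L_inf v w \<subseteq> sector (rho v w k1) (- rho v w k2)"
    proof
      fix z assume "z \<in> uminus ` L_inf v w"
      then obtain r where r: "r < 0" "z = - (of_real r * Z v w (0, 1))" by (auto simp: L_inf_def)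
      have "z = of_real r * d" using r by (simp add: d_def)
      hence "z = of_real (- r * s) * rho v w k1 + of_real (- r * t) * (- rho v w k2)"
        unfolding d by (simp add: algebra_simps)
      moreover have "- r * s > 0" "- r * t > 0" using r st by (auto simp: mult_neg_pos)
      ultimately show "z \<in> sector (rho v w k1) (- rho v w k2)"
        unfolding sector_def by (intro CollectI exI[of _ "- r * s"] exI[of _ "- r * t"]) auto
    qed
    thus ?thesis using 2 by blast
  qed
qed

end

theory Submission
  imports Defs
begin

text \<open>
  Put \<open>x = Z\<^sub>\<gamma> / \<lambda>\<^sub>B\<close>. After rescaling, the exponent of \<open>\<Y>\<^sub>\<gamma>\<close> is \<open>x + s * cnj x\<close> with
  \<open>s = R\<^sup>2 \<bar>\<lambda>\<^sub>B\<bar>\<^sup>2\<close>, so its real part is \<open>(1 + s) * Re x\<close>. On the overlaps all charges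
  occurring in the cocycles satisfy \<open>Re x < 0\<close>, so every factor converges, and the logarithms of the
  factors of an infinite product are dominated, uniformly in \<open>0 < s < 1\<close>, by a series of the form
  \<open>\<Sum>n. C * (n + 1) * r ^ n\<close> with \<open>r < 1\<close>. Tannery's theorem then gives convergence of
  the products.
\<close>

subsection \<open>The Rogers dilogarithm\<close>

text \<open>Pulling out one factor \<open>x\<close> leaves a genuine power series in
  \<open>x ^ n\<close>, the form that the continuity theorem for power series expects.\<close>

lemma Li2_altdef: "Li2 x = x * (\<Sum>n. (1 / of_nat (Suc n) ^ 2) * x ^ n)" if "norm x < 1"
proof -
  have "summable (\<lambda>n. (1 / of_nat (Suc n) ^ 2) * x ^ n)"
  proof (rule summable_comparison_test[OF _ summable_geometric])
    show "\<exists>N. \<forall>n\<ge>N. norm (1 / of_nat (Suc n) ^ 2 * x ^ n) \<le> norm x ^ n"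
      by (auto simp: norm_mult norm_divide norm_power divide_simps mult_left_le mult_le_cancel_left1
               simp del: of_nat_Suc intro!: exI[of _ 0])
  qed (use that in simp)
  from suminf_mult[OF this, of x] show ?thesis
    by (simp add: Li2_def mult_ac)
qed

lemma isCont_Li2:
  assumes "norm x < 1"
  shows "isCont Li2 x"
proof -
  \<comment> \<open>Summability at a real point of modulus strictly between \<open>norm x\<close>
    and 1 yields continuity at \<open>x\<close>.\<close>
  obtain r where r: "norm x < r" "r < 1" using assms dense by blast
  hence r0: "0 < r" using norm_ge_zero[of x] by linarith
  have "summable (\<lambda>n. (1 / of_nat (Suc n) ^ 2) * (of_real r :: complex) ^ n)"
  proof (rule summable_comparison_test[OF _ summable_geometric])
    show "\<exists>N. \<forall>n\<ge>N. norm (1 / of_nat (Suc n) ^ 2 * (of_real r :: complex) ^ n) \<le> r ^ n"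
      using r0 by (auto simp: norm_mult norm_divide norm_power divide_simps mult_le_cancel_left1
               simp del: of_nat_Suc intro!: exI[of _ 0])
  qed (use r r0 in simp)
  hence "isCont (\<lambda>x. x * (\<Sum>n. (1 / of_nat (Suc n) ^ 2) * x ^ n)) x"
    by (intro continuous_intros isCont_powser) (use r r0 in auto)
  moreover have "eventually (\<lambda>x. Li2 x = x * (\<Sum>n. (1 / of_nat (Suc n) ^ 2) * x ^ n)) (nhds x)"
  proof -
    have "eventually (\<lambda>y. y \<in> ball 0 1) (nhds x)"
      using assms by (intro eventually_nhds_in_open) auto
    thus ?thesis by eventually_elim (rule Li2_altdef, simp)
  qed
  ultimately show ?thesis by (simp add: isCont_cong)
qed

text \<open>A negative real part puts \<open>exp e\<close> into the open unit disc, so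
  \<open>1 - exp e\<close> has positive real part and stays off the branch cut of
  \<open>Ln\<close>.\<close>

lemma isCont_Rogers:
  assumes "Re e < 0"
  shows "isCont Rogers e"
proof -
  have n: "norm (exp e) < 1" using assms by simp
  have "Re (exp e) < 1" using complex_Re_le_cmod[of "exp e"] n by linarith
  hence "1 - exp e \<notin> \<real>\<^sub>\<le>\<^sub>0" by (auto simp: complex_nonpos_Reals_iff)
  moreover have "isCont (\<lambda>e. Li2 (exp e)) e"
    by (rule isCont_o2[where f = exp and g = Li2]) (use isCont_Li2[OF n] in auto)
  ultimately show ?thesis
    unfolding Rogers_def[abs_def] by (intro continuous_intros) auto
qed

text \<open>Dropping the denominators leaves a geometric series with sum |x| / (1 - |x|), and |x| is
  at most 1/2.\<close>

lemma norm_Li2_le: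
  assumes "norm x \<le> 1 / 2"
  shows "norm (Li2 x) \<le> 2 * norm x"
proof -
  have geo: "(\<lambda>n. norm x * norm x ^ n) sums (norm x * (1 / (1 - norm x)))"
    using assms by (intro sums_mult geometric_sums) auto
  have "norm (Li2 x) \<le> (\<Sum>n. norm x * norm x ^ n)"
    unfolding Li2_def
  proof (rule norm_suminf_le)
    show "norm (x ^ Suc n / of_nat (Suc n) ^ 2) \<le> norm x * norm x ^ n" for n
    proof -
      have "norm x ^ Suc n / real (Suc n) ^ 2 \<le> norm x ^ Suc n / 1"
        by (rule frac_le) (auto simp del: of_nat_Suc)
      thus ?thesis by (simp add: norm_divide norm_power norm_mult del: of_nat_Suc)
    qed
  qed (use geo in \<open>auto simp: sums_iff\<close>)
  also have "\<dots> = norm x * (1 / (1 - norm x))" using geo by (simp add: sums_iff)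
  also have "\<dots> \<le> norm x * 2"
    using assms by (intro mult_left_mono) (auto simp: divide_simps)
  finally show ?thesis by simp
qed

text \<open>The factor linear in \<open>norm e\<close> comes from the chosen logarithm
  \<open>e\<close>, which is unbounded along the products; \<open>exp e\<close> alone has to provide
  the decay.\<close>

lemma norm_Rogers_le:
  assumes "norm (exp e) < 1 / 2"
  shows "norm (Rogers e) \<le> (2 + norm e) * norm (exp e)"
proof -
  have "norm (Ln (1 + - exp e)) \<le> 2 * norm (- exp e)"
    using assms by (intro norm_Ln_le) (simp only: norm_minus_cancel)
  hence ln: "norm (Ln (1 - exp e)) \<le> 2 * norm (exp e)" by (simp only: norm_minus_cancel) simp
  have "norm (Rogers e) \<le> norm (Li2 (exp e)) + norm (1 / 2 * e * Ln (1 - exp e))"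
    unfolding Rogers_def by (rule norm_triangle_ineq)
  also have "\<dots> \<le> 2 * norm (exp e) + 1 / 2 * norm e * (2 * norm (exp e))"
    unfolding norm_mult using assms by (intro add_mono norm_Li2_le mult_mono ln) auto
  finally show ?thesis by (simp add: algebra_simps)
qed

subsection \<open>Deformed exponents\<close>

definition deform :: "real \<Rightarrow> complex \<Rightarrow> complex" where
  "deform s e = e + of_real s * cnj e"

lemma Re_deform: "Re (deform s e) = (1 + s) * Re e"
  by (simp add: deform_def algebra_simps)

lemma norm_deform_le:
  assumes "0 \<le> s" "s \<le> 1"
  shows "norm (deform s e) \<le> 2 * norm e"
proof -
  have "norm (deform s e) \<le> norm e + norm (of_real s * cnj e)"
    unfolding deform_def by (rule norm_triangle_ineq)
  also have "\<dots> \<le> norm e + 1 * norm e"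
    using assms unfolding norm_mult by (intro add_mono mult_mono) auto
  finally show ?thesis by simp
qed

lemma tendsto_Rogers_deform:
  assumes "Re e < 0"
  shows "((\<lambda>s. Rogers (deform s e)) \<longlongrightarrow> Rogers e) (at_right 0)"
proof (rule isCont_tendsto_compose[OF isCont_Rogers[OF assms]])
  have "((\<lambda>s. e + of_real s * cnj e) \<longlongrightarrow> e + of_real 0 * cnj e) (at_right 0)"
    by (intro tendsto_intros)
  thus "((\<lambda>s. deform s e) \<longlongrightarrow> e) (at_right 0)" by (simp add: deform_def)
qed

text \<open>The product is the exponential of a series, to which dominated convergence for series
  applies. The majorant is required only for large \<open>k\<close> and for \<open>x\<close> far
  along \<open>F\<close>. The limit is again an exponential, hence nonzero, which later allows
  inverses to be taken.\<close>

lemma tendsto_prodinf_exp: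
  fixes a :: "nat \<Rightarrow> 'b \<Rightarrow> complex"
  assumes "\<And>k. ((\<lambda>x. a k x) \<longlongrightarrow> b k) F"
    and bound: "eventually (\<lambda>(k, x). norm (a k x) \<le> M k) (at_top \<times>\<^sub>F F)"
    and "summable M" "F \<noteq> bot"
  shows "((\<lambda>x. \<Prod>k. exp (a k x)) \<longlongrightarrow> (\<Prod>k. exp (b k))) F" (is ?lim)
    and "(\<Prod>k. exp (b k)) \<noteq> 0"
proof -
  note T = tannerys_theorem[OF assms]
  have b: "(\<Prod>k. exp (b k)) = exp (suminf b)"
    using T by (intro prodinf_exp) (auto intro: summable_norm_cancel)
  have "eventually (\<lambda>x. exp (\<Sum>k. a k x) = (\<Prod>k. exp (a k x))) F"
    using conjunct1[OF T]
    by eventually_elim (auto intro!: prodinf_exp[symmetric] dest: summable_norm_cancel)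
  moreover have "((\<lambda>x. exp (\<Sum>k. a k x)) \<longlongrightarrow> exp (suminf b)) F"
    using T by (intro tendsto_exp) auto
  ultimately show ?lim
    unfolding b by (simp add: tendsto_cong)
  show "(\<Prod>k. exp (b k)) \<noteq> 0" unfolding b by simp
qed

text \<open>Along an arithmetic progression of exponents with \<open>Re b < 0\<close> the
  exponentials decay geometrically while the exponents grow linearly, so the logarithms of the
  factors are summable.\<close>

lemma tendsto_prodinf_Rogers_deform:
  fixes a b c :: complex
  assumes b: "Re b < 0" and neg: "\<And>n. Re (a + of_nat n * b) < 0"
  defines "e \<equiv> \<lambda>n. a + of_nat n * b"
  shows "((\<lambda>s. \<Prod>n. exp (c * Rogers (deform s (e n)))) \<longlongrightarrow> (\<Prod>n. exp (c * Rogers (e n))))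
           (at_right 0)"
    and "(\<Prod>n. exp (c * Rogers (e n))) \<noteq> 0"
proof -
  define r where "r = exp (Re b)"
  \<comment> \<open>Chosen so that \<open>D * (n + 1)\<close> bounds the factor
    \<open>2 + norm (deform s (e n))\<close> of the dilogarithm estimate.\<close>
  define D where "D = 2 + 2 * norm a + 2 * norm b"
  define M where "M = (\<lambda>n. norm c * D * exp (Re a) * (of_nat (Suc n) * r ^ n))"
  have r: "0 < r" "r < 1" using b by (auto simp: r_def)
  have normexp: "exp (Re (e n)) = exp (Re a) * r ^ n" for n
    by (simp add: e_def r_def exp_add exp_of_nat_mult)
  have summ: "summable M"
    unfolding M_def using r
    by (intro summable_mult sums_summable[OF geometric_deriv_sums]) auto
  have bound: "norm (c * Rogers (deform s (e n))) \<le> M n"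
    if "exp (Re a) * r ^ n < 1 / 2" "0 < s" "s < 1" for n s
  proof -
    \<comment> \<open>As \<open>Re (e n)\<close> is negative, the deformation only shrinks the
      exponential; this makes the bound uniform in \<open>s\<close>.\<close>
    have "(1 + s) * Re (e n) \<le> Re (e n)"
      using mult_pos_neg[OF that(2) neg[of n]] by (simp add: e_def algebra_simps)
    hence le: "norm (exp (deform s (e n))) \<le> exp (Re a) * r ^ n"
      by (simp add: Re_deform flip: normexp)
    have "norm (deform s (e n)) \<le> 2 * norm (e n)"
      using that by (intro norm_deform_le) auto
    also have "norm (e n) \<le> norm a + of_nat n * norm b"
      unfolding e_def by (rule order.trans[OF norm_triangle_ineq]) (simp add: norm_mult)
    finally have "2 + norm (deform s (e n)) \<le> 2 + 2 * norm a + 2 * (of_nat n * norm b)" by simp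
    also have "\<dots> \<le> D * of_nat (Suc n)"
      unfolding D_def by (simp add: algebra_simps)
    finally have D: "2 + norm (deform s (e n)) \<le> D * of_nat (Suc n)" .
    have "norm (Rogers (deform s (e n))) \<le>
            (2 + norm (deform s (e n))) * norm (exp (deform s (e n)))"
      using le that by (intro norm_Rogers_le) linarith
    also have "\<dots> \<le> (D * of_nat (Suc n)) * (exp (Re a) * r ^ n)"
      by (rule mult_mono[OF D le]) (auto simp: D_def)
    finally have "norm c * norm (Rogers (deform s (e n))) \<le>
        norm c * ((D * of_nat (Suc n)) * (exp (Re a) * r ^ n))"
      by (rule mult_left_mono) simp
    thus ?thesis by (simp add: M_def norm_mult mult_ac)
  qed
  \<comment> \<open>The threshold 1/2 of the dilogarithm estimate is met for all but finitely many
    \<open>n\<close>; the remaining factors need only their pointwise limits.\<close>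
  have "(\<lambda>n. exp (Re a) * r ^ n) \<longlonglongrightarrow> exp (Re a) * 0"
    using r by (intro tendsto_intros LIMSEQ_power_zero) auto
  hence "eventually (\<lambda>n. exp (Re a) * r ^ n < 1 / 2) at_top"
    by (rule order_tendstoD) simp
  moreover have "eventually (\<lambda>s::real. 0 < s \<and> s < 1) (at_right 0)"
    by (auto simp: eventually_at_right_field intro!: exI[of _ 1])
  ultimately have ev: "eventually (\<lambda>(n, s). norm (c * Rogers (deform s (e n))) \<le> M n)
      (at_top \<times>\<^sub>F at_right 0)"
    unfolding eventually_prod_filter using bound by blast
  have lim: "((\<lambda>s. c * Rogers (deform s (e n))) \<longlongrightarrow> c * Rogers (e n)) (at_right 0)" for n
    by (intro tendsto_intros tendsto_Rogers_deform) (use neg in \<open>simp add: e_def\<close>)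
  note T = tendsto_prodinf_exp[OF lim ev summ trivial_limit_at_right_real]
  show "((\<lambda>s. \<Prod>n. exp (c * Rogers (deform s (e n)))) \<longlongrightarrow> (\<Prod>n. exp (c * Rogers (e n))))
          (at_right 0)" by (rule T(1))
  show "(\<Prod>n. exp (c * Rogers (e n))) \<noteq> 0" by (rule T(2))
qed

subsection \<open>The conformal limit of the factors\<close>

lemma X_exponent_altdef:
  "X_exponent l v w (n, m) =
     of_int n * X_exponent l v w (1, 0) + of_int m * X_exponent l v w (0, 1)"
  by (simp add: X_exponent_def Z_def algebra_simps add_divide_distrib)

lemma Re_X_exponent:
  "Re (X_exponent l v w (n, m)) =
     of_int n * Re (X_exponent l v w (1, 0)) + of_int m * Re (X_exponent l v w (0, 1))"
  by (subst X_exponent_altdef) simp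

lemma X_exponent_uminus: "X_exponent l v w (- \<gamma>) = - X_exponent l v w \<gamma>"
proof -
  have "Z v w (- \<gamma>) = - Z v w \<gamma>" by (simp add: Z_def algebra_simps)
  thus ?thesis by (simp add: X_exponent_def)
qed

text \<open>In the first summand \<open>R\<close> cancels. In the second it appears squared, and l *
  cnj Z equals |l|^2 * cnj (Z / l).\<close>

lemma Y_exponent_eq_deform:
  assumes "R \<noteq> 0" "l \<noteq> 0"
  shows "Y_exponent (of_real R * l) (of_real R * v) (of_real R * w) \<gamma> =
         deform (R\<^sup>2 * (norm l)\<^sup>2) (X_exponent l v w \<gamma>)"
proof -
  have "of_real ((norm l)\<^sup>2) * cnj (Z v w \<gamma> / l) = l * cnj (Z v w \<gamma>)"
    using assms unfolding complex_norm_square by (simp add: field_simps)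
  hence eq: "of_real (R\<^sup>2 * (norm l)\<^sup>2) * cnj (Z v w \<gamma> / l) = of_real (R\<^sup>2) * (l * cnj (Z v w \<gamma>))"
    by (simp only: of_real_mult mult.assoc)
  thus ?thesis
    unfolding Y_exponent_def deform_def X_exponent_def Z_scale eq
    using assms by (simp add: field_simps power2_eq_square)
qed

text \<open>Convergence to 0 is not enough for composing with a one-sided limit: the new parameter
  must also stay positive.\<close>

lemma filterlim_conformal_scale:
  assumes "l \<noteq> 0"
  shows "filterlim (\<lambda>R. R\<^sup>2 * (norm l)\<^sup>2) (at_right 0) (at_right (0::real))"
proof -
  have "((\<lambda>R. R\<^sup>2 * (norm l)\<^sup>2) \<longlongrightarrow> 0\<^sup>2 * (norm l)\<^sup>2) (at_right (0::real))"
    by (intro tendsto_intros)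
  moreover have "eventually (\<lambda>R. R\<^sup>2 * (norm l)\<^sup>2 > 0) (at_right (0::real))"
    using assms eventually_at_right_less[of "0::real"] by (auto elim!: eventually_mono)
  ultimately show ?thesis
    unfolding filterlim_at by (auto elim!: eventually_mono)
qed

section \<open>Passage from the deformation parameter to \<open>R\<close>, and limits of the
  products of factors\<close>

lemma trans_same_nonzero: "trans_same E s k1 k2 \<noteq> 0"
  by (simp add: trans_same_def factor_def)

context
  fixes l v w :: complex
  assumes l: "l \<noteq> 0"
begin

text \<open>Substitution of R^2 |l|^2 for \<open>s\<close>. The functional \<open>G\<close> is
  arbitrary, so that finite and infinite products are treated alike.\<close>

lemma conformal_transfer:
  assumes "((\<lambda>s. G (\<lambda>\<gamma>. deform s (X_exponent l v w \<gamma>))) \<longlongrightarrow> L) (at_right 0)"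
  shows "((\<lambda>R. G (Y_exponent (of_real R * l) (of_real R * v) (of_real R * w))) \<longlongrightarrow> L) (at_right 0)"
proof (rule Lim_transform_eventually[OF filterlim_compose[OF assms filterlim_conformal_scale[OF l]]])
  show "eventually (\<lambda>R. G (\<lambda>\<gamma>. deform (R\<^sup>2 * (norm l)\<^sup>2) (X_exponent l v w \<gamma>)) =
          G (Y_exponent (of_real R * l) (of_real R * v) (of_real R * w))) (at_right 0)"
    using eventually_at_right_less[of "0::real"]
    by eventually_elim
       (rule arg_cong[where f = G], use l in \<open>auto simp: fun_eq_iff Y_exponent_eq_deform\<close>)
qed

lemma tendsto_trans_same:
  assumes "\<And>k. k \<in> {k1..<k2} \<Longrightarrow> Re (X_exponent l v w (sg s, sg s * k)) < 0"
  shows "((\<lambda>R. trans_same (Y_exponent (of_real R * l) (of_real R * v) (of_real R * w)) s k1 k2)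
           \<longlongrightarrow> trans_same (X_exponent l v w) s k1 k2) (at_right 0)"
  unfolding trans_same_def factor_def
  \<comment> \<open>The placeholder \<open>_ k\<close> is left to unification, which fills in the
    coefficient containing \<open>Omega\<close>.\<close>
  by (rule conformal_transfer[of "\<lambda>E. \<Prod>k\<in>{k1..<k2}. exp (_ k * Rogers (E (sg s, sg s * k)))"])
     (intro tendsto_intros tendsto_Rogers_deform assms)

text \<open>Charges in a string of direction \<open>(0, q)\<close> have exponents in arithmetic
  progression, and a constant \<open>Omega\<close> gives all factors the same coefficient.\<close>

lemma tendsto_prodinf_factor:
  fixes n m p q :: int
  assumes \<gamma>: "\<And>j. \<gamma> j = (n, m) + (0, int j * q)"
    and q: "of_int q * Re (X_exponent l v w (0, 1)) < 0"
    and neg: "\<And>j. Re (X_exponent l v w (\<gamma> j)) < 0"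
    and Omega: "\<And>j. Omega (\<gamma> j) = p"
  shows "((\<lambda>R. \<Prod>j. factor (Y_exponent (of_real R * l) (of_real R * v) (of_real R * w)) (\<gamma> j))
           \<longlongrightarrow> (\<Prod>j. factor (X_exponent l v w) (\<gamma> j))) (at_right 0)"
    and "(\<Prod>j. factor (X_exponent l v w) (\<gamma> j)) \<noteq> 0"
proof -
  define a where "a = X_exponent l v w (n, m)"
  define b where "b = of_int q * X_exponent l v w (0, 1)"
  define c :: complex where "c = of_int p / (2 * of_real pi * \<i>)"
  \<comment> \<open>Fixing \<open>n\<close> in the rewrite rule keeps it from applying to
    \<open>(1, 0)\<close> and \<open>(0, 1)\<close>, where it would loop.\<close>
  have X: "X_exponent l v w (\<gamma> j) = a + of_nat j * b" for j
    unfolding \<gamma> a_def b_def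
    by (simp add: X_exponent_altdef[of l v w n] X_exponent_altdef[of l v w n m] algebra_simps)
  have b: "Re b < 0" using q by (simp add: b_def)
  have neg': "Re (a + of_nat j * b) < 0" for j using neg[of j] by (simp only: X)
  note T = tendsto_prodinf_Rogers_deform[OF b neg', of c]
  show "((\<lambda>R. \<Prod>j. factor (Y_exponent (of_real R * l) (of_real R * v) (of_real R * w)) (\<gamma> j))
           \<longlongrightarrow> (\<Prod>j. factor (X_exponent l v w) (\<gamma> j))) (at_right 0)"
    unfolding factor_def Omega X c_def[symmetric]
    by (rule conformal_transfer[of "\<lambda>E. \<Prod>j. exp (c * Rogers (E (\<gamma> j)))"])
       (simp only: X T(1))
  show "(\<Prod>j. factor (X_exponent l v w) (\<gamma> j)) \<noteq> 0"
    unfolding factor_def Omega X c_def[symmetric] by (rule T(2))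
qed

text \<open>The hypotheses make the real part negative for every charge in the three products. Each
  product runs along a string of step \<open>(0, 1)\<close>.\<close>

lemma tendsto_trans_inf:
  assumes "Re (X_exponent l v w (0, 1)) < 0"
    and "\<And>k. k \<ge> k1 \<Longrightarrow> Re (X_exponent l v w (1, k)) < 0"
    and "\<And>k. k < k2 \<Longrightarrow> Re (X_exponent l v w (1, k)) > 0"
  shows "((\<lambda>R. trans_inf (Y_exponent (of_real R * l) (of_real R * v) (of_real R * w)) k1 k2)
           \<longlongrightarrow> trans_inf (X_exponent l v w) k1 k2) (at_right 0)" (is ?lim)
    and "trans_inf (X_exponent l v w) k1 k2 \<noteq> 0" (is ?nz)
proof -
  have 1: "Re (X_exponent l v w (1, k1 + int j)) < 0" for j
    by (rule assms(2)) simp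
  have 2: "Re (X_exponent l v w (- (1, k2 - 1 - int j))) < 0" for j
    using assms(3)[of "k2 - 1 - int j"] unfolding X_exponent_uminus by simp
  have 3: "Re (X_exponent l v w (0, 1 + int j)) < 0" for j
    using assms(1) Re_X_exponent[of l v w 0 "1 + int j"] by (simp add: mult_pos_neg)
  have q: "of_int 1 * Re (X_exponent l v w (0, 1)) < 0" using assms(1) by simp
  note P1 = tendsto_prodinf_factor[of "\<lambda>j. (1, k1 + int j)" 1 k1 1 1, OF _ q 1]
  \<comment> \<open>Negation turns the descending product into the ascending string from
    \<open>(-1, 1 - k2)\<close>.\<close>
  note P2 = tendsto_prodinf_factor[of "\<lambda>j. - (1, k2 - 1 - int j)" "-1" "1 - k2" 1 1, OF _ q 2]
  note P3 = tendsto_prodinf_factor[of "\<lambda>j. (0, 1 + int j)" 0 1 1 "-2", OF _ q 3]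
  show ?lim
    unfolding trans_inf_def prod_from_def prod_below_def
    by (intro tendsto_mult P1(1) P2(1) P3(1)) (auto simp: Omega_def)
  have "(\<Prod>j. factor (X_exponent l v w) (1, k1 + int j)) \<noteq> 0"
    by (rule P1(2)) (auto simp: Omega_def)
  moreover have "(\<Prod>j. factor (X_exponent l v w) (- (1, k2 - 1 - int j))) \<noteq> 0"
    by (rule P2(2)) (auto simp: Omega_def)
  moreover have "(\<Prod>j. factor (X_exponent l v w) (0, 1 + int j)) \<noteq> 0"
    by (rule P3(2)) (auto simp: Omega_def)
  ultimately show ?nz
    unfolding trans_inf_def prod_from_def prod_below_def by simp
qed

text \<open>Mirror image of the previous case: the strings have step \<open>(0, -1)\<close>, the
  direction in which the real part now decreases.\<close>

lemma tendsto_trans_minf: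
  assumes "Re (X_exponent l v w (0, 1)) > 0"
    and "\<And>k. k \<ge> k2 \<Longrightarrow> Re (X_exponent l v w (1, k)) > 0"
    and "\<And>k. k < k1 \<Longrightarrow> Re (X_exponent l v w (1, k)) < 0"
  shows "((\<lambda>R. trans_minf (Y_exponent (of_real R * l) (of_real R * v) (of_real R * w)) k2 k1)
           \<longlongrightarrow> trans_minf (X_exponent l v w) k2 k1) (at_right 0)" (is ?lim)
    and "trans_minf (X_exponent l v w) k2 k1 \<noteq> 0" (is ?nz)
proof -
  have 1: "Re (X_exponent l v w (- (1, k2 + int j))) < 0" for j
    using assms(2)[of "k2 + int j"] unfolding X_exponent_uminus by simp
  have 2: "Re (X_exponent l v w (1, k1 - 1 - int j)) < 0" for j
    by (rule assms(3)) simp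
  have 3: "Re (X_exponent l v w (- (0, 1 + int j))) < 0" for j
    using assms(1) Re_X_exponent[of l v w 0 "1 + int j"]
    unfolding X_exponent_uminus by simp
  have q: "of_int (- 1) * Re (X_exponent l v w (0, 1)) < 0" using assms(1) by simp
  note P1 = tendsto_prodinf_factor[of "\<lambda>j. - (1, k2 + int j)" "-1" "-k2" "-1" 1, OF _ q 1]
  note P2 = tendsto_prodinf_factor[of "\<lambda>j. (1, k1 - 1 - int j)" 1 "k1 - 1" "-1" 1, OF _ q 2]
  note P3 = tendsto_prodinf_factor[of "\<lambda>j. - (0, 1 + int j)" 0 "-1" "-1" "-2", OF _ q 3]
  show ?lim
    unfolding trans_minf_def prod_from_def prod_below_def
    by (intro tendsto_mult P1(1) P2(1) P3(1)) (auto simp: Omega_def)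
  have "(\<Prod>j. factor (X_exponent l v w) (- (1, k2 + int j))) \<noteq> 0"
    by (rule P1(2)) (auto simp: Omega_def)
  moreover have "(\<Prod>j. factor (X_exponent l v w) (1, k1 - 1 - int j)) \<noteq> 0"
    by (rule P2(2)) (auto simp: Omega_def)
  moreover have "(\<Prod>j. factor (X_exponent l v w) (- (0, 1 + int j))) \<noteq> 0"
    by (rule P3(2)) (auto simp: Omega_def)
  ultimately show ?nz
    unfolding trans_minf_def prod_from_def prod_below_def by simp
qed

end

subsection \<open>Signs on the overlaps\<close>

text \<open>The middle ray is spanned by a negative multiple of the central charge of the fractional
  charge \<beta> + x \<delta>, so the half-plane condition is a sign condition on its
  exponent.\<close>

lemma U_imp_Re_X_exponent:
  assumes "(l, v, w) \<in> U (s, k)"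
  obtains x where "of_int k - 1 < x" "x < of_int k"
    "of_int (sg s) * (Re (X_exponent l v w (1, 0)) + x * Re (X_exponent l v w (0, 1))) < 0"
proof -
  have l: "l \<noteq> 0" and M: "(v, w) \<in> M_plus"
    and pos: "l \<bullet> (of_int (sg s) * rho v w k) > 0"
    using assms by (auto simp: half_plane_def)
  have w: "w \<noteq> 0" using M by (auto simp: M_plus_def)
  \<comment> \<open>The real inner product of \<open>l\<close> with a central charge is the real
    part of cnj l * Z, that is, of |l|^2 * Z / l.\<close>
  have inner: "l \<bullet> Z v w \<gamma> = (norm l)\<^sup>2 * Re (X_exponent l v w \<gamma>)" for \<gamma>
    using l by (simp add: X_exponent_def inner_complex_def Re_divide cmod_power2)
  obtain c x where cx: "c > 0" "of_int k - 1 < x" "x < of_int k"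
      "rho v w k = of_real c * (- Z v w (0, 1)) * (v / w + of_real x)"
    using rho_form[OF M, of k] by blast
  have rho: "of_int (sg s) * rho v w k =
          (- of_int (sg s) * c) *\<^sub>R (Z v w (1, 0) + x *\<^sub>R Z v w (0, 1))"
    unfolding cx(4) using w by (simp add: Z_def scaleR_conv_of_real field_simps)
  have "l \<bullet> (of_int (sg s) * rho v w k) =
           - (c * (norm l)\<^sup>2) * (of_int (sg s) *
               (Re (X_exponent l v w (1, 0)) + x * Re (X_exponent l v w (0, 1))))"
    unfolding rho inner_scaleR_right inner_add_right inner by (simp add: algebra_simps)
  moreover have "c * (norm l)\<^sup>2 > 0" using cx l by simp
  ultimately have "of_int (sg s) *
      (Re (X_exponent l v w (1, 0)) + x * Re (X_exponent l v w (0, 1))) < 0"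
    using pos by (simp add: zero_less_mult_iff mult_less_0_iff)
  with cx show ?thesis using that by blast
qed

lemma affine_neg_between:
  fixes p q :: real
  assumes "p + x * q < 0" "p + y * q < 0" "x \<le> k" "k \<le> y"
  shows "p + k * q < 0"
proof (cases "q \<ge> 0")
  case True
  thus ?thesis using assms mult_right_mono[of k y q] by linarith
next
  case False
  thus ?thesis using assms mult_right_mono_neg[of x k q] by linarith
qed

text \<open>The two half-planes make the affine function \<open>p + t * q\<close> negative at some
  \<open>x < k1\<close> and some \<open>y > k2 - 1\<close>; every integer from \<open>k1\<close> to
  \<open>k2 - 1\<close> lies between them.\<close>

lemma same_sign_Re_neg:
  assumes "(l, v, w) \<in> U (s, k1)" "(l, v, w) \<in> U (s, k2)" "k \<in> {k1..<k2}"
  shows "Re (X_exponent l v w (sg s, sg s * k)) < 0"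
proof -
  define p where "p = of_int (sg s) * Re (X_exponent l v w (1, 0))"
  define q where "q = of_int (sg s) * Re (X_exponent l v w (0, 1))"
  obtain x where x: "x < of_int k1" "p + x * q < 0"
    by (rule U_imp_Re_X_exponent[OF assms(1)]) (simp add: p_def q_def distrib_left mult.left_commute)
  obtain y where y: "of_int k2 - 1 < y" "p + y * q < 0"
    by (rule U_imp_Re_X_exponent[OF assms(2)]) (simp add: p_def q_def distrib_left mult.left_commute)
  have "k1 \<le> k" "k \<le> k2 - 1" using assms(3) by auto
  hence "x \<le> of_int k" "of_int k \<le> y" using x(1) y(1) by linarith+
  from affine_neg_between[OF x(2) y(2) this] show ?thesis
    using Re_X_exponent[of l v w "sg s" "sg s * k"] by (simp add: p_def q_def mult_ac)
qed

text \<open>The affine function \<open>p + t * q\<close> is negative at \<open>x\<close> and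
  positive at \<open>y\<close>, so the order of \<open>x\<close> and \<open>y\<close>, which is that
  of \<open>k1\<close> and \<open>k2\<close>, fixes the sign of its slope. Monotonicity then settles
  all integers beyond the two points.\<close>

lemma opposite_sign_Re:
  assumes "(l, v, w) \<in> U (Plus, k1)" "(l, v, w) \<in> U (Minus, k2)"
  shows "k2 < k1 \<Longrightarrow> Re (X_exponent l v w (0, 1)) < 0"
    and "k2 < k1 \<Longrightarrow> k \<ge> k1 \<Longrightarrow> Re (X_exponent l v w (1, k)) < 0"
    and "k2 < k1 \<Longrightarrow> k < k2 \<Longrightarrow> Re (X_exponent l v w (1, k)) > 0"
    and "k1 < k2 \<Longrightarrow> Re (X_exponent l v w (0, 1)) > 0"
    and "k1 < k2 \<Longrightarrow> k \<ge> k2 \<Longrightarrow> Re (X_exponent l v w (1, k)) > 0"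
    and "k1 < k2 \<Longrightarrow> k < k1 \<Longrightarrow> Re (X_exponent l v w (1, k)) < 0"
proof -
  define p where "p = Re (X_exponent l v w (1, 0))"
  define q where "q = Re (X_exponent l v w (0, 1))"
  obtain x where x: "of_int k1 - 1 < x" "x < of_int k1" "p + x * q < 0"
    by (rule U_imp_Re_X_exponent[OF assms(1)]) (simp add: p_def q_def)
  obtain y where y: "of_int k2 - 1 < y" "y < of_int k2" "p + y * q > 0"
    by (rule U_imp_Re_X_exponent[OF assms(2)]) (simp add: p_def q_def)
  have X: "Re (X_exponent l v w (1, k)) = p + of_int k * q"
    using Re_X_exponent[of l v w 1 k] by (simp add: p_def q_def)
  have "(x - y) * q < 0" using x(3) y(3) by (simp add: algebra_simps)
  hence sgn: "x > y \<Longrightarrow> q < 0" "x < y \<Longrightarrow> q > 0"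
    by (auto simp: mult_less_0_iff)
  have q_neg: "q < 0" if "k2 < k1"
  proof (rule sgn)
    have "of_int k2 \<le> (of_int k1 - 1 :: real)" using that by linarith
    thus "x > y" using x y by linarith
  qed
  have q_pos: "q > 0" if "k1 < k2"
  proof (rule sgn)
    have "of_int k1 \<le> (of_int k2 - 1 :: real)" using that by linarith
    thus "x < y" using x y by linarith
  qed
  show "Re (X_exponent l v w (0, 1)) < 0" if "k2 < k1"
    using q_neg[OF that] by (simp add: q_def)
  show "Re (X_exponent l v w (0, 1)) > 0" if "k1 < k2"
    using q_pos[OF that] by (simp add: q_def)
  show "Re (X_exponent l v w (1, k)) < 0" if "k2 < k1" "k \<ge> k1"
  proof -
    have "x \<le> of_int k" using that x by linarith
    thus ?thesis
      unfolding X using x(3) mult_right_mono_neg[of x "of_int k" q] q_neg[OF that(1)] by linarith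
  qed
  show "Re (X_exponent l v w (1, k)) > 0" if "k2 < k1" "k < k2"
  proof -
    have "of_int k \<le> y" using that y by linarith
    thus ?thesis
      unfolding X using y(3) mult_right_mono_neg[of "of_int k" y q] q_neg[OF that(1)] by linarith
  qed
  show "Re (X_exponent l v w (1, k)) > 0" if "k1 < k2" "k \<ge> k2"
  proof -
    have "y \<le> of_int k" using that y by linarith
    thus ?thesis
      unfolding X using y(3) mult_right_mono[of y "of_int k" q] q_pos[OF that(1)] by linarith
  qed
  show "Re (X_exponent l v w (1, k)) < 0" if "k1 < k2" "k < k1"
  proof -
    have "of_int k \<le> x" using that x by linarith
    thus ?thesis
      unfolding X using x(3) mult_right_mono[of "of_int k" x q] q_pos[OF that(1)] by linarith
  qed
qed

subsection \<open>The transition functions\<close>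

text \<open>On an overlap the order of the indices decides which of the two rays lies in the sector.
  The case distinction thus becomes independent of \<open>v\<close> and \<open>w\<close>, hence of
  the rescaling.\<close>

lemma trans_opp_eq:
  assumes "(l, v, w) \<in> U (Plus, k1)" "(l, v, w) \<in> U (Minus, k2)"
  shows "trans_opp v w E k1 k2 =
           (if k2 < k1 then trans_inf E k1 k2 else inverse (trans_minf E k2 k1))"
proof -
  have cases: "k2 < k1 \<and> L_inf v w \<subseteq> sector (rho v w k1) (- rho v w k2) \<or>
         k1 < k2 \<and> uminus ` L_inf v w \<subseteq> sector (rho v w k1) (- rho v w k2)"
    using assms by (intro opposite_cases[of l]) auto
  \<comment> \<open>The sector lies in the open half-plane around \<open>l\<close>, so it cannot contain opposite rays.\<close>
  have sector: "l \<bullet> z > 0" if z: "z \<in> sector (rho v w k1) (- rho v w k2)" for z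
  proof -
    obtain s t where st: "s \<ge> 0" "t \<ge> 0" "(s, t) \<noteq> (0, 0)"
        "z = s *\<^sub>R rho v w k1 + t *\<^sub>R (- rho v w k2)"
      using z unfolding sector_def scaleR_conv_of_real by blast
    have pos: "l \<bullet> rho v w k1 > 0" "l \<bullet> (- rho v w k2) > 0"
      using assms by (auto simp: half_plane_def)
    have "s > 0 \<or> t > 0" using st(1-3) by auto
    hence "s * (l \<bullet> rho v w k1) + t * (l \<bullet> (- rho v w k2)) > 0"
    proof
      assume "s > 0"
      thus ?thesis using st(2) pos by (intro add_pos_nonneg mult_pos_pos mult_nonneg_nonneg) simp_all
    next
      assume "t > 0"
      thus ?thesis using st(1) pos by (intro add_nonneg_pos mult_pos_pos mult_nonneg_nonneg) simp_all
    qed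
    thus ?thesis unfolding st(4) inner_add_right inner_scaleR_right .
  qed
  have "- Z v w (0, 1) \<in> L_inf v w"
    unfolding L_inf_def by (auto intro!: exI[of _ "-1"])
  hence "\<not> (L_inf v w \<subseteq> sector (rho v w k1) (- rho v w k2) \<and>
             uminus ` L_inf v w \<subseteq> sector (rho v w k1) (- rho v w k2))"
    using sector[of "- Z v w (0, 1)"] sector[of "Z v w (0, 1)"] by force
  with cases show ?thesis by (auto simp: trans_opp_def)
qed

lemma tendsto_trans_opp:
  assumes U: "(l, v, w) \<in> U (Plus, k1)" "(l, v, w) \<in> U (Minus, k2)"
  shows "((\<lambda>R. trans_opp (of_real R * v) (of_real R * w)
             (Y_exponent (of_real R * l) (of_real R * v) (of_real R * w)) k1 k2)
           \<longlongrightarrow> trans_opp v w (X_exponent l v w) k1 k2) (at_right 0)" (is ?lim)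
    and "trans_opp v w (X_exponent l v w) k1 k2 \<noteq> 0" (is ?nz)
proof -
  have l: "l \<noteq> 0" using U by auto
  \<comment> \<open>In \<open>T\<close> the rescaling enters through the exponents only.\<close>
  define T where "T = (\<lambda>E. if k2 < k1 then trans_inf E k1 k2 else inverse (trans_minf E k2 k1))"
  have "k1 \<noteq> k2" using opposite_cases[of l v w k1 k2] U by blast
  then consider "k2 < k1" | "k1 < k2" by linarith
  hence T: "((\<lambda>R. T (Y_exponent (of_real R * l) (of_real R * v) (of_real R * w)))
      \<longlongrightarrow> T (X_exponent l v w)) (at_right 0) \<and> T (X_exponent l v w) \<noteq> 0"
  proof cases
    case 1
    note I = tendsto_trans_inf[OF l opposite_sign_Re(1-3)[OF U 1]]
    show ?thesis using 1 I by (simp add: T_def)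
  next
    case 2
    note M = tendsto_trans_minf[OF l opposite_sign_Re(4-6)[OF U 2]]
    show ?thesis using 2 M(2) tendsto_inverse[OF M] by (simp add: T_def)
  qed
  have eq: "trans_opp v w (X_exponent l v w) k1 k2 = T (X_exponent l v w)"
    by (simp add: T_def trans_opp_eq[OF U])
  have "eventually (\<lambda>R. T (Y_exponent (of_real R * l) (of_real R * v) (of_real R * w)) =
          trans_opp (of_real R * v) (of_real R * w)
             (Y_exponent (of_real R * l) (of_real R * v) (of_real R * w)) k1 k2) (at_right 0)"
    \<comment> \<open>For every \<open>R > 0\<close> the rescaled point lies in the same overlap, so
      the same case applies.\<close>
    using eventually_at_right_less[of "0::real"]
    by eventually_elim (simp add: T_def trans_opp_eq[OF U_scale[OF _ U(1)] U_scale[OF _ U(2)]])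
  thus ?lim unfolding eq by (rule Lim_transform_eventually[OF conjunct1[OF T]])
  show ?nz unfolding eq using T by blast
qed

theorem proposition4p20:
  fixes i j :: "sign \<times> int" and lamB v w :: complex
  assumes "(lamB, v, w) \<in> U i \<inter> U j"
  shows "((\<lambda>R::real. h i j (of_real R * lamB, of_real R * v, of_real R * w))
           \<longlongrightarrow> g_tilde i j (lamB, v, w)) (at_right 0)"
proof -
  obtain s k1 t k2 where ij: "i = (s, k1)" "j = (t, k2)" by (cases i, cases j)
  have Ui: "(lamB, v, w) \<in> U (s, k1)" and Uj: "(lamB, v, w) \<in> U (t, k2)"
    using assms unfolding ij by auto
  have l: "lamB \<noteq> 0" using Ui by auto
  have same: "((\<lambda>R. trans_same (Y_exponent (of_real R * lamB) (of_real R * v) (of_real R * w)) s m1 m2)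
      \<longlongrightarrow> trans_same (X_exponent lamB v w) s m1 m2) (at_right 0)"
    if "(lamB, v, w) \<in> U (s, m1)" "(lamB, v, w) \<in> U (s, m2)" for s m1 m2
    by (rule tendsto_trans_same[OF l same_sign_Re_neg[OF that]])
  show ?thesis
  proof (cases "s = t")
    case True
    consider "k1 < k2" | "k2 < k1" | "k1 = k2" by linarith
    thus ?thesis
    proof cases
      case 1
      thus ?thesis using same[OF Ui] Uj True by (cases t) (auto simp: ij)
    next
      case 2
      thus ?thesis using tendsto_inverse[OF same[OF Uj] trans_same_nonzero] Ui True
        by (cases t) (auto simp: ij)
    next
      case 3
      thus ?thesis using True by (cases t) (auto simp: ij)
    qed
  next
    case False
    then consider "s = Plus" "t = Minus" | "s = Minus" "t = Plus"
      by (cases s; cases t) auto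
    thus ?thesis
    proof cases
      case 1
      thus ?thesis using tendsto_trans_opp(1)[of lamB v w k1 k2] Ui Uj by (simp add: ij)
    next
      case 2
      thus ?thesis
        \<comment> \<open>\<open>tendsto_trans_opp\<close> supplies both the limit and its
          non-vanishing, which the inverse needs.\<close>
        using tendsto_inverse[OF tendsto_trans_opp[of lamB v w k2 k1]] Ui Uj by (simp add: ij)
    qed
  qed
qed

end
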